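(* Let $G = (G, \cdot)$ be a group. The following data are equivalent, in the sense that under the standard bijective correspondences between operations $\circ$ on $G$ making $(G,\cdot,\circ)$ a skew brace, regular subgroups $N \le \operatorname{Hol}(G)$, and gamma functions $\gamma : G \to \operatorname{Aut}(G)$ (recalled in the context), the following conditions on the corresponding $\circ$, $N$, $\gamma$ are equivalent (and in (6) the function $\gamma$ is not assumed in advance to be a gamma function): \begin{enumerate} \item[(1)] a skew brace $(G, \cdot, \circ)$ such that $\operatorname{Aut}(G, \cdot) \le \operatorname{Aut}(G, \circ)$; \item[(2)] a skew brace $(G, \cdot, \circ)$ which is unique of its isomorphism type among skew braces with additive group $(G, \cdot)$; \item[(3)] a regular subgroup $N \trianglelefteq \operatorname{Hol}(G)$; \item[(4)] a regular subgroup $N \le \operatorname{Hol}(G)$ which is normalised by $\operatorname{Aut}(G)$; \item[(5)] a gamma function $\gamma : G \to \operatorname{Aut}(G)$ which satisfies $\gamma(x^{\beta}) = \gamma(x)^{\beta}$ for all $x \in G$, $\beta \in \operatorname{Aut}(G)$; \item[(6)] a function $\gamma : G \to \operatorname{Aut}(G)$ which satisfies $\gamma(x y) = \gamma(y)\gamma(x)$ for all $x, y \in G$, and $\gamma(x^{\beta}) = \gamma(x)^{\beta}$ for all $x \in G$, $\beta \in \operatorname{Aut}(G)$. \end{enumerate} Moreover, the skew braces $(G,\cdot,\circ)$ satisfying these conditions are all bi-skew braces.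
   Context: Maps act on the right and are written as exponents, and products of maps are composed left to right; for elements $u,v$ of a group, $u^{v} = v^{-1} u v$. A (right) skew brace with additive group $(G,\cdot)$ is a triple $(G,\cdot,\circ)$ where $(G,\circ)$ is also a group and $(x y) \circ z = (x \circ z) \cdot z^{-1} \cdot (y \circ z)$ for all $x,y,z \in G$ (here $z^{-1}$ is the inverse in $(G,\cdot)$). It is a bi-skew brace if $(G,\circ,\cdot)$ is also a skew brace. An isomorphism of skew braces is a bijection preserving both operations; "unique of its isomorphism type" means that if $(G,\cdot,\circ')$ is a skew brace isomorphic to $(G,\cdot,\circ)$, then $\circ' = \circ$. A gamma function on $G$ is a function $\gamma : G \to \operatorname{Aut}(G)$ such that $\gamma(g^{\gamma(h)} h) = \gamma(g)\gamma(h)$ for all $g,h \in G$. Let $S(G)$ be the group of permutations of the set $G$, and $\rho : G \to S(G)$, $g \mapsto (x \mapsto xg)$. The holomorph is $\operatorname{Hol}(G) = N_{S(G)}(\rho(G)) = \operatorname{Aut}(G)\rho(G)$. A subgroup of $S(G)$ is regular if it is transitive with trivial point stabilisers. Correspondences: a gamma function $\gamma$ corresponds to the skew brace operation $x \circ y = x^{\gamma(y)} y$ and to the regular subgroup $N = \{\gamma(y)\rho(y) : y \in G\} = \{x \mapsto x \circ y : y \in G\}$ of $\operatorname{Hol}(G)$. These give bijections between operations $\circ$ such that $(G,\cdot,\circ)$ is a skew brace, regular subgroups of $\operatorname{Hol}(G)$, and gamma functions on $G$. *)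

theory Defs
  imports "HOL-Algebra.Bij" "HOL-Algebra.Group_Action"
begin

text \<open>Maps act on the right, so products of permutations are composed from left to right: this is
  the opposite of \<^const>\<open>BijGroup\<close>.\<close>

definition perm_group :: "'a set \<Rightarrow> ('a \<Rightarrow> 'a) monoid" where
  "perm_group S = (BijGroup S)\<lparr>mult := \<lambda>f g. g \<otimes>\<^bsub>BijGroup S\<^esub> f\<rparr>"

lemma perm_group_simps:
  "carrier (perm_group S) = Bij S"
  "f \<in> Bij S \<Longrightarrow> g \<in> Bij S \<Longrightarrow> f \<otimes>\<^bsub>perm_group S\<^esub> g = (\<lambda>x\<in>S. g (f x))"
  "\<one>\<^bsub>perm_group S\<^esub> = (\<lambda>x\<in>S. x)"
  by (auto simp: perm_group_def BijGroup_def compose_def)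

lemma group_perm_group: "group (perm_group S)"
proof -
  interpret B: group "BijGroup S" by (rule group_BijGroup)
  show ?thesis
    by (rule groupI) (auto simp: perm_group_def B.m_assoc intro: B.r_inv)
qed

text \<open>Automorphisms and permutations are extensional functions on the carrier.\<close>

definition right_mult :: "('a, 'b) monoid_scheme \<Rightarrow> 'a \<Rightarrow> 'a \<Rightarrow> 'a" where
  "right_mult G g = (\<lambda>x\<in>carrier G. x \<otimes>\<^bsub>G\<^esub> g)"

definition Hol :: "('a, 'b) monoid_scheme \<Rightarrow> ('a \<Rightarrow> 'a) monoid" where
  "Hol G = (perm_group (carrier G))
     \<lparr>carrier := normalizer (perm_group (carrier G)) (right_mult G ` carrier G)\<rparr>"

definition regular :: "'a set \<Rightarrow> ('a \<Rightarrow> 'a) set \<Rightarrow> bool" where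
  "regular S N \<longleftrightarrow> subgroup N (perm_group S)
     \<and> (\<forall>x\<in>S. \<forall>y\<in>S. \<exists>f\<in>N. f x = y)
     \<and> (\<forall>x\<in>S. {f \<in> N. f x = x} = {\<one>\<^bsub>perm_group S\<^esub>})"

definition regular_subgroups_Hol :: "('a, 'b) monoid_scheme \<Rightarrow> ('a \<Rightarrow> 'a) set set" where
  "regular_subgroups_Hol G = {N. subgroup N (Hol G) \<and> regular (carrier G) N}"

text \<open>A skew brace is a pair of groups \<open>G\<close> (additive) and \<open>H\<close> (circle) on the same carrier.\<close>

definition skew_brace :: "('a, 'b) monoid_scheme \<Rightarrow> ('a, 'c) monoid_scheme \<Rightarrow> bool" where
  "skew_brace G H \<longleftrightarrow> group G \<and> group H \<and> carrier H = carrier G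
     \<and> (\<forall>x\<in>carrier G. \<forall>y\<in>carrier G. \<forall>z\<in>carrier G.
          (x \<otimes>\<^bsub>G\<^esub> y) \<otimes>\<^bsub>H\<^esub> z = (x \<otimes>\<^bsub>H\<^esub> z) \<otimes>\<^bsub>G\<^esub> inv\<^bsub>G\<^esub> z \<otimes>\<^bsub>G\<^esub> (y \<otimes>\<^bsub>H\<^esub> z))"

definition bi_skew_brace :: "('a, 'b) monoid_scheme \<Rightarrow> ('a, 'c) monoid_scheme \<Rightarrow> bool" where
  "bi_skew_brace G H \<longleftrightarrow> skew_brace G H \<and> skew_brace H G"

definition skew_brace_iso ::
  "('a, 'b) monoid_scheme \<Rightarrow> ('a, 'c) monoid_scheme \<Rightarrow>
   ('d, 'e) monoid_scheme \<Rightarrow> ('d, 'f) monoid_scheme \<Rightarrow> ('a \<Rightarrow> 'd) set" where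
  "skew_brace_iso G H G' H' = iso G G' \<inter> iso H H'"

text \<open>The operation of a group as an extensional function: two operations on the same carrier are
  the same mathematical object iff these are equal, whereas the field \<^const>\<open>mult\<close> itself may
  differ outside the carrier.\<close>

definition operation :: "('a, 'b) monoid_scheme \<Rightarrow> 'a \<Rightarrow> 'a \<Rightarrow> 'a" where
  "operation H = (\<lambda>x\<in>carrier H. \<lambda>y\<in>carrier H. x \<otimes>\<^bsub>H\<^esub> y)"

definition skew_brace_operations :: "('a, 'b) monoid_scheme \<Rightarrow> ('a \<Rightarrow> 'a \<Rightarrow> 'a) set" where
  "skew_brace_operations G = {operation H | H :: 'a monoid. skew_brace G H}"

definition unique_of_iso_type :: "('a, 'b) monoid_scheme \<Rightarrow> 'a monoid \<Rightarrow> bool" where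
  "unique_of_iso_type G H \<longleftrightarrow>
     (\<forall>H' :: 'a monoid. skew_brace G H' \<and> skew_brace_iso G H' G H \<noteq> {}
        \<longrightarrow> operation H' = operation H)"

definition gamma_function :: "('a, 'b) monoid_scheme \<Rightarrow> ('a \<Rightarrow> 'a \<Rightarrow> 'a) \<Rightarrow> bool" where
  "gamma_function G \<gamma> \<longleftrightarrow> \<gamma> \<in> carrier G \<rightarrow>\<^sub>E auto G
     \<and> (\<forall>g\<in>carrier G. \<forall>h\<in>carrier G.
          \<gamma> (\<gamma> h g \<otimes>\<^bsub>G\<^esub> h) = \<gamma> g \<otimes>\<^bsub>perm_group (carrier G)\<^esub> \<gamma> h)"

definition gamma_equivariant :: "('a, 'b) monoid_scheme \<Rightarrow> ('a \<Rightarrow> 'a \<Rightarrow> 'a) \<Rightarrow> bool" where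
  "gamma_equivariant G \<gamma> \<longleftrightarrow> (\<forall>x\<in>carrier G. \<forall>\<beta>\<in>auto G.
     \<gamma> (\<beta> x) = inv\<^bsub>perm_group (carrier G)\<^esub> \<beta> \<otimes>\<^bsub>perm_group (carrier G)\<^esub> \<gamma> x
                \<otimes>\<^bsub>perm_group (carrier G)\<^esub> \<beta>)"

definition gamma_antihom :: "('a, 'b) monoid_scheme \<Rightarrow> ('a \<Rightarrow> 'a \<Rightarrow> 'a) \<Rightarrow> bool" where
  "gamma_antihom G \<gamma> \<longleftrightarrow> (\<forall>x\<in>carrier G. \<forall>y\<in>carrier G.
     \<gamma> (x \<otimes>\<^bsub>G\<^esub> y) = \<gamma> y \<otimes>\<^bsub>perm_group (carrier G)\<^esub> \<gamma> x)"

definition gamma_operation :: "('a, 'b) monoid_scheme \<Rightarrow> ('a \<Rightarrow> 'a \<Rightarrow> 'a) \<Rightarrow> 'a \<Rightarrow> 'a \<Rightarrow> 'a" where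
  "gamma_operation G \<gamma> = (\<lambda>x\<in>carrier G. \<lambda>y\<in>carrier G. \<gamma> y x \<otimes>\<^bsub>G\<^esub> y)"

definition gamma_subgroup :: "('a, 'b) monoid_scheme \<Rightarrow> ('a \<Rightarrow> 'a \<Rightarrow> 'a) \<Rightarrow> ('a \<Rightarrow> 'a) set" where
  "gamma_subgroup G \<gamma> =
     {\<gamma> y \<otimes>\<^bsub>perm_group (carrier G)\<^esub> right_mult G y | y. y \<in> carrier G}"

end

theory Submission
  imports Defs
begin

text \<open>A gamma function is recovered from \<open>\<circ>\<close> by \<open>x\<^sup>\<gamma>\<^sup>(\<^sup>y\<^sup>) = (x \<circ> y) y\<^sup>-\<^sup>1\<close>, and from
  \<open>N\<close> by splitting the element of \<open>N\<close> that sends \<open>1\<close> to \<open>y\<close> as \<open>\<gamma>(y)\<rho>(y)\<close>; the first factor is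
  an automorphism because \<open>Aut(G)\<close> is exactly the stabiliser of \<open>1\<close> in the normaliser of \<open>\<rho>(G)\<close>.
  The same description of automorphisms, applied to \<open>(G, \<circ>)\<close>, shows that \<open>\<beta> \<in> Aut(G)\<close> normalises
  \<open>N\<close> iff it is an automorphism of \<open>\<circ>\<close>, which written out is the equivariance of \<open>\<gamma>\<close>. Uniqueness
  in the isomorphism class enters by transporting \<open>\<circ>\<close> along \<open>\<beta>\<close>. For the bi-skew brace property,
  with \<open>z'\<close> the \<open>\<circ>\<close>-inverse of \<open>z\<close>, the antihomomorphism law gives
  \<open>z' \<circ> (y z) = (z\<^sup>\<gamma>\<^sup>(\<^sup>y\<^sup>))\<^sup>-\<^sup>1 y z\<close>, whose gamma value is \<open>\<gamma>(y)\<close>.\<close>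

subsection \<open>Permutations and the holomorph\<close>

lemma perm_group_apply:
  "f \<in> Bij S \<Longrightarrow> g \<in> Bij S \<Longrightarrow> x \<in> S \<Longrightarrow> (f \<otimes>\<^bsub>perm_group S\<^esub> g) x = g (f x)"
  by (simp add: perm_group_simps(2))

lemma perm_group_m_closed:
  "f \<in> Bij S \<Longrightarrow> g \<in> Bij S \<Longrightarrow> f \<otimes>\<^bsub>perm_group S\<^esub> g \<in> Bij S"
  using group.subgroup_self group_perm_group perm_group_simps(1) subgroup.m_closed by metis

lemma perm_group_inv_closed: "f \<in> Bij S \<Longrightarrow> inv\<^bsub>perm_group S\<^esub> f \<in> Bij S"
  using group.inv_closed[OF group_perm_group] by (simp add: perm_group_simps(1))

lemma Bij_mem: "f \<in> Bij S \<Longrightarrow> x \<in> S \<Longrightarrow> f x \<in> S"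
  using Bij_imp_funcset by fastforce

lemma Bij_eq_iff: "f \<in> Bij S \<Longrightarrow> f x = f y \<longleftrightarrow> x = y" if "x \<in> S" "y \<in> S"
  using that by (auto simp: Bij_def bij_betw_def inj_on_def)

lemma Bij_eqI: "f \<in> Bij S \<Longrightarrow> g \<in> Bij S \<Longrightarrow> (\<And>x. x \<in> S \<Longrightarrow> f x = g x) \<Longrightarrow> f = g"
  by (meson Bij_imp_extensional extensionalityI)

lemma perm_group_inv_apply:
  assumes "f \<in> Bij S" "x \<in> S"
  shows "(inv\<^bsub>perm_group S\<^esub> f) (f x) = x" "f ((inv\<^bsub>perm_group S\<^esub> f) x) = x"
proof -
  interpret P: group "perm_group S" by (rule group_perm_group)
  have "(f \<otimes>\<^bsub>perm_group S\<^esub> inv\<^bsub>perm_group S\<^esub> f) x = x"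
    "(inv\<^bsub>perm_group S\<^esub> f \<otimes>\<^bsub>perm_group S\<^esub> f) x = x"
    using assms by (simp_all add: perm_group_simps)
  then show "(inv\<^bsub>perm_group S\<^esub> f) (f x) = x" "f ((inv\<^bsub>perm_group S\<^esub> f) x) = x"
    using assms by (simp_all add: perm_group_apply perm_group_inv_closed)
qed

lemma BijI:
  assumes "f \<in> extensional S" "\<And>x. x \<in> S \<Longrightarrow> f x \<in> S" "\<And>x. x \<in> S \<Longrightarrow> g x \<in> S"
    "\<And>x. x \<in> S \<Longrightarrow> g (f x) = x" "\<And>x. x \<in> S \<Longrightarrow> f (g x) = x"
  shows "f \<in> Bij S"
  unfolding Bij_def using assms by (auto intro!: bij_betw_byWitness[where f' = g])

text \<open>The library defines \<open>normalizer\<close> as the stabiliser of \<open>H\<close>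
  under conjugation. Clearing the inverse leaves an equality of cosets, which can be checked element
  by element.\<close>

lemma (in group) mem_normalizer_iff:
  assumes "H \<subseteq> carrier G"
  shows "f \<in> normalizer G H \<longleftrightarrow> f \<in> carrier G \<and> H #> f = f <# H"
proof -
  have *: "f <# H #> inv f = H \<longleftrightarrow> H #> f = f <# H" if f: "f \<in> carrier G"
  proof -
    have sub: "f <# H \<subseteq> carrier G" using assms f by (auto simp: l_coset_def)
    have "f <# H #> inv f #> f = f <# H"
      using sub f by (simp add: coset_mult_assoc)
    moreover have "H #> f #> inv f = H"
      using assms f by (simp add: coset_mult_assoc)
    ultimately show ?thesis by metis
  qed
  show ?thesis using assms * by (auto simp: normalizer_def stabilizer_def)
qed

section \<open>Right translations and the right regular representation\<close>

context group
begin

abbreviation perms where "perms \<equiv> perm_group (carrier G)"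
abbreviation right_mults where "right_mults \<equiv> right_mult G ` carrier G"

lemma right_mult_Bij: "y \<in> carrier G \<Longrightarrow> right_mult G y \<in> Bij (carrier G)"
  by (rule BijI[where g = "\<lambda>x. x \<otimes> inv y"]) (auto simp: right_mult_def m_assoc)

lemma right_mult_apply: "x \<in> carrier G \<Longrightarrow> right_mult G y x = x \<otimes> y"
  by (simp add: right_mult_def)

lemma right_mults_subset: "right_mults \<subseteq> carrier perms"
  using right_mult_Bij by (auto simp: perm_group_simps)

text \<open>Composing from left to right makes \<open>right_mult G\<close> a homomorphism into
  \<open>perms\<close> rather than an antihomomorphism.\<close>

lemma right_mult_mult:
  assumes "x \<in> carrier G" "y \<in> carrier G"
  shows "right_mult G x \<otimes>\<^bsub>perms\<^esub> right_mult G y = right_mult G (x \<otimes> y)"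
  by (rule Bij_eqI[where S = "carrier G"])
    (use assms in \<open>auto simp: perm_group_apply perm_group_m_closed right_mult_Bij right_mult_apply m_assoc\<close>)

lemma right_mult_one: "right_mult G \<one> = \<one>\<^bsub>perms\<^esub>"
  by (rule Bij_eqI[where S = "carrier G"])
    (auto simp: right_mult_Bij right_mult_apply perm_group_simps id_Bij)

lemma right_mult_inv:
  assumes "x \<in> carrier G"
  shows "inv\<^bsub>perms\<^esub> (right_mult G x) = right_mult G (inv x)"
  using assms
  by (intro group.inv_equality[OF group_perm_group])
    (auto simp: right_mult_mult right_mult_one perm_group_simps(1) right_mult_Bij)

text \<open>This is Cayley's right regular representation. Applied to the circle group instead of
  \<open>G\<close>, it later yields the regularity of the subgroup attached to a gamma
  function.\<close>

lemma regular_right_mults: "regular (carrier G) right_mults"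
  unfolding regular_def
proof (intro conjI ballI)
  show "subgroup right_mults perms"
    using right_mults_subset
    by (intro group.subgroupI[OF group_perm_group]) (auto simp: right_mult_inv right_mult_mult)
next
  fix x y assume "x \<in> carrier G" "y \<in> carrier G"
  then show "\<exists>f\<in>right_mults. f x = y"
    by (intro bexI[where x = "right_mult G (inv x \<otimes> y)"])
      (auto simp: right_mult_apply simp flip: m_assoc)
next
  fix x assume "x \<in> carrier G"
  then show "{f \<in> right_mults. f x = x} = {\<one>\<^bsub>perms\<^esub>}"
    by (auto simp: right_mult_apply right_mult_one[symmetric])
qed

section \<open>Automorphisms as the stabiliser of the identity in the normaliser\<close>

lemma auto_Bij: "f \<in> auto G \<Longrightarrow> f \<in> Bij (carrier G)"
  by (simp add: auto_def)

lemma auto_mem: "f \<in> auto G \<Longrightarrow> x \<in> carrier G \<Longrightarrow> f x \<in> carrier G"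
  by (auto simp: auto_def intro: Bij_mem)

lemma auto_mult:
  "f \<in> auto G \<Longrightarrow> x \<in> carrier G \<Longrightarrow> y \<in> carrier G \<Longrightarrow> f (x \<otimes> y) = f x \<otimes> f y"
  by (simp add: auto_def hom_def)

lemma auto_group_hom: "f \<in> auto G \<Longrightarrow> group_hom G G f"
  by (simp add: auto_def group_hom_def group_hom_axioms_def)

lemma auto_one: "f \<in> auto G \<Longrightarrow> f \<one> = \<one>"
  by (rule group_hom.hom_one[OF auto_group_hom])

lemma auto_inv: "f \<in> auto G \<Longrightarrow> x \<in> carrier G \<Longrightarrow> f (inv x) = inv (f x)"
  by (rule group_hom.hom_inv[OF auto_group_hom])

lemma auto_inv_apply:
  assumes "f \<in> auto G" "x \<in> carrier G"
  obtains x' where "x' \<in> carrier G" "f x' = x"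
  using assms auto_Bij perm_group_inv_apply(2) perm_group_inv_closed Bij_mem by metis

text \<open>Conjugation by an automorphism \<open>f\<close> turns the translation by
  \<open>y\<close> into the translation by \<open>f y\<close>, and surjectivity of \<open>f\<close>
  makes the two cosets equal. Conversely, normalising sends the translation by \<open>y\<close> to
  some translation by \<open>z\<close>, and fixing \<one> forces \<open>z\<close> to be
  \<open>f y\<close>, which is multiplicativity.\<close>

lemma auto_iff_normalizer:
  "f \<in> auto G \<longleftrightarrow> f \<in> normalizer perms right_mults \<and> f \<one> = \<one>"
proof
  assume f: "f \<in> auto G"
  have B: "f \<in> Bij (carrier G)" using f by (rule auto_Bij)
  have *: "right_mult G y \<otimes>\<^bsub>perms\<^esub> f = f \<otimes>\<^bsub>perms\<^esub> right_mult G (f y)" if "y \<in> carrier G" for y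
    using f B that auto_mem[OF f]
    by (intro Bij_eqI[where S = "carrier G"])
      (auto simp: perm_group_apply perm_group_m_closed right_mult_Bij right_mult_apply auto_mult)
  have "right_mults #>\<^bsub>perms\<^esub> f = f <#\<^bsub>perms\<^esub> right_mults"
  proof (intro equalityI subsetI)
    fix u assume "u \<in> right_mults #>\<^bsub>perms\<^esub> f"
    then show "u \<in> f <#\<^bsub>perms\<^esub> right_mults"
      using * auto_mem[OF f] by (auto simp: r_coset_def l_coset_def)
  next
    fix u assume "u \<in> f <#\<^bsub>perms\<^esub> right_mults"
    then obtain z where z: "z \<in> carrier G" "u = f \<otimes>\<^bsub>perms\<^esub> right_mult G z"
      by (auto simp: l_coset_def)
    obtain y where "y \<in> carrier G" "f y = z" using auto_inv_apply f z(1) by blast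
    then show "u \<in> right_mults #>\<^bsub>perms\<^esub> f"
      using * z by (auto simp: r_coset_def)
  qed
  then show "f \<in> normalizer perms right_mults \<and> f \<one> = \<one>"
    using f B right_mults_subset
    by (auto simp: group.mem_normalizer_iff[OF group_perm_group] perm_group_simps(1) auto_one)
next
  assume f: "f \<in> normalizer perms right_mults \<and> f \<one> = \<one>"
  then have B: "f \<in> Bij (carrier G)"
    and eq: "right_mults #>\<^bsub>perms\<^esub> f = f <#\<^bsub>perms\<^esub> right_mults"
    using right_mults_subset
    by (auto simp: group.mem_normalizer_iff[OF group_perm_group] perm_group_simps(1))
  have "f (x \<otimes> y) = f x \<otimes> f y" if x: "x \<in> carrier G" and y: "y \<in> carrier G" for x y
  proof -
    have "right_mult G y \<otimes>\<^bsub>perms\<^esub> f \<in> f <#\<^bsub>perms\<^esub> right_mults"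
      using y by (auto simp: r_coset_def simp flip: eq)
    then obtain z where z: "z \<in> carrier G"
      and "right_mult G y \<otimes>\<^bsub>perms\<^esub> f = f \<otimes>\<^bsub>perms\<^esub> right_mult G z"
      by (auto simp: l_coset_def)
    then have *: "f (u \<otimes> y) = f u \<otimes> z" if "u \<in> carrier G" for u
      using that y B Bij_mem[OF B that]
        perm_group_apply[OF B right_mult_Bij[OF z] that] perm_group_apply[OF right_mult_Bij[OF y] B that]
      by (auto simp: right_mult_apply)
    \<comment> \<open>The element \<open>z\<close> depends only on \<open>y\<close>, so evaluation
      at the identity determines it.\<close>
    from *[of \<one>] y z f have "f y = z" by simp
    with *[OF x] show ?thesis by simp
  qed
  then show "f \<in> auto G"
    using B by (auto simp: auto_def hom_def intro: Bij_mem)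
qed

section \<open>The holomorph and normality in it\<close>

lemma carrier_Hol: "carrier (Hol G) = normalizer perms right_mults"
  by (simp add: Hol_def)

lemma subgroup_Hol: "subgroup (carrier (Hol G)) perms"
  unfolding carrier_Hol
  using group.normalizer_imp_subgroup[OF group_perm_group] right_mults_subset by blast

lemma group_Hol: "group (Hol G)"
  using subgroup.subgroup_is_group[OF subgroup_Hol group_perm_group] by (simp add: Hol_def)

lemma auto_subset_Hol: "auto G \<subseteq> carrier (Hol G)"
  using auto_iff_normalizer carrier_Hol by blast

text \<open>For \<open>h\<close> in \<open>H\<close> both cosets in the criterion collapse to
  \<open>H\<close>.\<close>

lemma subgroup_subset_normalizer:
  assumes "subgroup H G" shows "H \<subseteq> normalizer G H"
proof
  fix h assume "h \<in> H"
  then show "h \<in> normalizer G H"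
    using assms coset_join2[of h H]
    by (metis coset_join3 mem_normalizer_iff subgroup.mem_carrier subgroup.subset)
qed

lemma right_mults_subset_Hol: "right_mults \<subseteq> carrier (Hol G)"
  unfolding carrier_Hol
  using group.subgroup_subset_normalizer[OF group_perm_group] regular_right_mults regular_def by blast

text \<open>Dividing \<open>f\<close> on the right by the translation that carries \<one> to
  \<open>f \<one>\<close> leaves an element of the holomorph fixing \<one>, hence an automorphism.
  This is the factorisation Hol(G) = Aut(G) \<rho>(G).\<close>

lemma Hol_decomposition:
  assumes f: "f \<in> carrier (Hol G)"
  obtains \<alpha> where "\<alpha> \<in> auto G" "f = \<alpha> \<otimes>\<^bsub>perms\<^esub> right_mult G (f \<one>)" "f \<one> \<in> carrier G"
proof -
  interpret P: group perms by (rule group_perm_group)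
  interpret H: subgroup "carrier (Hol G)" perms by (rule subgroup_Hol)
  have B: "f \<in> Bij (carrier G)" using f H.subset by (auto simp: perm_group_simps(1))
  let ?y = "f \<one>"
  let ?\<alpha> = "f \<otimes>\<^bsub>perms\<^esub> inv\<^bsub>perms\<^esub> right_mult G ?y"
  have y: "?y \<in> carrier G" using B by (simp add: Bij_mem)
  have R: "right_mult G ?y \<in> carrier (Hol G)" using y right_mults_subset_Hol by blast
  have "?\<alpha> \<in> carrier (Hol G)" using f R by blast
  moreover have "?\<alpha> \<one> = \<one>"
    using B y perm_group_inv_apply(1)[OF right_mult_Bij[OF y] one_closed]
    by (simp add: perm_group_apply perm_group_inv_closed right_mult_Bij right_mult_apply)
  ultimately have "?\<alpha> \<in> auto G" by (simp add: auto_iff_normalizer carrier_Hol)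
  moreover have "f = ?\<alpha> \<otimes>\<^bsub>perms\<^esub> right_mult G ?y"
    using f R H.subset by (simp add: P.m_assoc subset_iff)
  ultimately show thesis using y that by blast
qed

text \<open>\<open>Hol G\<close> has the operation of \<open>perms\<close>, so its cosets are cosets
  in \<open>perms\<close>. Normality thereby becomes an inclusion of subgroups of
  \<open>perms\<close>, which can be tested on factors of elements of the holomorph.\<close>

lemma normal_Hol_iff:
  assumes "subgroup N (Hol G)"
  shows "N \<lhd> Hol G \<longleftrightarrow> carrier (Hol G) \<subseteq> normalizer perms N"
proof -
  have sub: "N \<subseteq> carrier perms" "carrier (Hol G) \<subseteq> carrier perms"
    using assms subgroup.subset subgroup_Hol by blast+
  have "N #>\<^bsub>Hol G\<^esub> x = N #>\<^bsub>perms\<^esub> x" "x <#\<^bsub>Hol G\<^esub> N = x <#\<^bsub>perms\<^esub> N" for x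
    by (simp_all add: r_coset_def l_coset_def Hol_def)
  then show ?thesis
    using assms group_Hol sub
    by (auto simp: normal_def normal_axioms_def group.mem_normalizer_iff[OF group_perm_group])
qed

end

text \<open>The quotient of \<open>f\<close> by \<open>g\<close> lies in \<open>N\<close> and fixes
  \<open>x\<close>, so it is trivial. An element of a regular subgroup is thus known from a single
  value.\<close>

lemma regular_unique:
  assumes N: "regular S N" and f: "f \<in> N" "g \<in> N" "x \<in> S" "f x = g x"
  shows "f = g"
proof -
  interpret P: group "perm_group S" by (rule group_perm_group)
  interpret N: subgroup N "perm_group S" using N by (simp add: regular_def)
  have B: "f \<in> Bij S" "g \<in> Bij S" using f N.subset by (auto simp: perm_group_simps(1))
  have "(f \<otimes>\<^bsub>perm_group S\<^esub> inv\<^bsub>perm_group S\<^esub> g) x = x"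
    using f B perm_group_inv_apply(1)[of g S x] by (simp add: perm_group_apply perm_group_inv_closed)
  moreover have "f \<otimes>\<^bsub>perm_group S\<^esub> inv\<^bsub>perm_group S\<^esub> g \<in> N" using f by blast
  ultimately have "f \<otimes>\<^bsub>perm_group S\<^esub> inv\<^bsub>perm_group S\<^esub> g = \<one>\<^bsub>perm_group S\<^esub>"
    using N f(3) unfolding regular_def by blast
  then show ?thesis
    using B by (metis P.inv_solve_right' P.l_one P.one_closed perm_group_simps(1))
qed

context group
begin

subsection \<open>Gamma functions\<close>

text \<open>Extensional bijections are equal once they agree on the carrier, which turns a law
  between permutations into a pointwise one. In the product \<open>\<gamma> g\<close> acts first,
  hence the reversed order on the right.\<close>

lemma gamma_function_apply_iff:
  assumes \<gamma>: "\<gamma> \<in> carrier G \<rightarrow>\<^sub>E auto G"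
  shows "gamma_function G \<gamma> \<longleftrightarrow>
    (\<forall>g\<in>carrier G. \<forall>h\<in>carrier G. \<forall>x\<in>carrier G. \<gamma> (\<gamma> h g \<otimes> h) x = \<gamma> h (\<gamma> g x))"
proof -
  have "\<gamma> (\<gamma> h g \<otimes> h) = \<gamma> g \<otimes>\<^bsub>perms\<^esub> \<gamma> h \<longleftrightarrow> (\<forall>x\<in>carrier G. \<gamma> (\<gamma> h g \<otimes> h) x = \<gamma> h (\<gamma> g x))"
    if g: "g \<in> carrier G" and h: "h \<in> carrier G" for g h
  proof -
    have A: "\<gamma> g \<in> auto G" "\<gamma> h \<in> auto G" using \<gamma> g h by blast+
    then have "\<gamma> (\<gamma> h g \<otimes> h) \<in> auto G" using \<gamma> g h auto_mem by blast
    with A have B: "\<gamma> g \<in> Bij (carrier G)" "\<gamma> h \<in> Bij (carrier G)" "\<gamma> (\<gamma> h g \<otimes> h) \<in> Bij (carrier G)"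
      using auto_Bij by blast+
    show ?thesis
      by (metis B Bij_eqI perm_group_apply perm_group_m_closed)
  qed
  then show ?thesis using \<gamma> by (simp add: gamma_function_def)
qed

lemma gamma_antihom_apply_iff:
  assumes \<gamma>: "\<gamma> \<in> carrier G \<rightarrow>\<^sub>E auto G"
  shows "gamma_antihom G \<gamma> \<longleftrightarrow>
    (\<forall>x\<in>carrier G. \<forall>y\<in>carrier G. \<forall>u\<in>carrier G. \<gamma> (x \<otimes> y) u = \<gamma> x (\<gamma> y u))"
proof -
  have "\<gamma> (x \<otimes> y) = \<gamma> y \<otimes>\<^bsub>perms\<^esub> \<gamma> x \<longleftrightarrow> (\<forall>u\<in>carrier G. \<gamma> (x \<otimes> y) u = \<gamma> x (\<gamma> y u))"
    if x: "x \<in> carrier G" and y: "y \<in> carrier G" for x y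
  proof -
    have B: "\<gamma> x \<in> Bij (carrier G)" "\<gamma> y \<in> Bij (carrier G)" "\<gamma> (x \<otimes> y) \<in> Bij (carrier G)"
      using \<gamma> x y auto_Bij by blast+
    show ?thesis
      by (metis B Bij_eqI perm_group_apply perm_group_m_closed)
  qed
  then show ?thesis by (simp add: gamma_antihom_def)
qed

text \<open>Evaluating at \<open>\<beta> u\<close> instead of \<open>u\<close> removes the inverse
  of \<open>\<beta>\<close>; nothing is lost, since \<open>\<beta>\<close> is onto.\<close>

lemma gamma_equivariant_apply_iff:
  assumes \<gamma>: "\<gamma> \<in> carrier G \<rightarrow>\<^sub>E auto G"
  shows "gamma_equivariant G \<gamma> \<longleftrightarrow>
    (\<forall>x\<in>carrier G. \<forall>\<beta>\<in>auto G. \<forall>u\<in>carrier G. \<gamma> (\<beta> x) (\<beta> u) = \<beta> (\<gamma> x u))"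
proof -
  have "\<gamma> (\<beta> x) = inv\<^bsub>perms\<^esub> \<beta> \<otimes>\<^bsub>perms\<^esub> \<gamma> x \<otimes>\<^bsub>perms\<^esub> \<beta>
      \<longleftrightarrow> (\<forall>u\<in>carrier G. \<gamma> (\<beta> x) (\<beta> u) = \<beta> (\<gamma> x u))" (is "_ = ?c \<longleftrightarrow> _")
    if x: "x \<in> carrier G" and \<beta>: "\<beta> \<in> auto G" for x \<beta>
  proof -
    have B: "\<beta> \<in> Bij (carrier G)" "\<gamma> x \<in> Bij (carrier G)" "\<gamma> (\<beta> x) \<in> Bij (carrier G)"
      using \<gamma> x \<beta> auto_Bij auto_mem[OF \<beta> x] by blast+
    have C: "?c \<in> Bij (carrier G)"
      using B by (simp add: perm_group_m_closed perm_group_inv_closed)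
    have c: "?c (\<beta> u) = \<beta> (\<gamma> x u)" if "u \<in> carrier G" for u
      using that B
      by (simp add: perm_group_apply perm_group_m_closed perm_group_inv_closed Bij_mem perm_group_inv_apply)
    show ?thesis
    proof
      assume "\<forall>u\<in>carrier G. \<gamma> (\<beta> x) (\<beta> u) = \<beta> (\<gamma> x u)"
      then have "\<gamma> (\<beta> x) v = ?c v" if "v \<in> carrier G" for v
        using auto_inv_apply[OF \<beta> that] c by metis
      then show "\<gamma> (\<beta> x) = ?c" using Bij_eqI B(3) C by blast
    qed (use c in simp)
  qed
  then show ?thesis by (simp add: gamma_equivariant_def)
qed

text \<open>Equivariance under the automorphism \<open>\<gamma> h\<close> itself gives
  \<open>\<gamma>(g)\<gamma>(h) = \<gamma>(h)\<gamma>(g\<^sup>\<gamma>\<^sup>(\<^sup>h\<^sup>))\<close>,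
  which turns the two functional equations into each other.\<close>

lemma equivariant_gamma_function_iff_antihom:
  assumes \<gamma>: "\<gamma> \<in> carrier G \<rightarrow>\<^sub>E auto G" and eq: "gamma_equivariant G \<gamma>"
  shows "gamma_function G \<gamma> \<longleftrightarrow> gamma_antihom G \<gamma>"
proof -
  have A: "\<gamma> x \<in> auto G" if "x \<in> carrier G" for x using \<gamma> that by blast
  have swap: "\<gamma> (\<gamma> h g) (\<gamma> h u) = \<gamma> h (\<gamma> g u)"
    if "g \<in> carrier G" "h \<in> carrier G" "u \<in> carrier G" for g h u
    using eq that A by (simp add: gamma_equivariant_apply_iff[OF \<gamma>])
  show ?thesis
    unfolding gamma_function_apply_iff[OF \<gamma>] gamma_antihom_apply_iff[OF \<gamma>]
  proof (intro iffI ballI)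
    fix x y u
    assume *: "\<forall>g\<in>carrier G. \<forall>h\<in>carrier G. \<forall>x\<in>carrier G. \<gamma> (\<gamma> h g \<otimes> h) x = \<gamma> h (\<gamma> g x)"
      and xyu: "x \<in> carrier G" "y \<in> carrier G" "u \<in> carrier G"
    \<comment> \<open>The gamma law concerns products of the form
      \<open>\<gamma> y x' \<otimes> y\<close>. Taking the preimage of \<open>x\<close> under
      \<open>\<gamma> y\<close> brings every product \<open>x \<otimes> y\<close> into that
      form.\<close>
    obtain x' where "x' \<in> carrier G" "\<gamma> y x' = x" using auto_inv_apply A xyu by metis
    then show "\<gamma> (x \<otimes> y) u = \<gamma> x (\<gamma> y u)"
      using * swap xyu by metis
  next
    fix g h x
    assume *: "\<forall>x\<in>carrier G. \<forall>y\<in>carrier G. \<forall>u\<in>carrier G. \<gamma> (x \<otimes> y) u = \<gamma> x (\<gamma> y u)"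
      and ghx: "g \<in> carrier G" "h \<in> carrier G" "x \<in> carrier G"
    show "\<gamma> (\<gamma> h g \<otimes> h) x = \<gamma> h (\<gamma> g x)"
      using * swap ghx A auto_mem by simp
  qed
qed

subsection \<open>Skew braces and regular subgroups\<close>

lemma operation_eq_iff:
  assumes carrier: "carrier H = carrier G"
  shows "operation H = gamma_operation G \<gamma> \<longleftrightarrow>
    (\<forall>x\<in>carrier G. \<forall>y\<in>carrier G. x \<otimes>\<^bsub>H\<^esub> y = \<gamma> y x \<otimes>\<^bsub>G\<^esub> y)"
proof
  assume "operation H = gamma_operation G \<gamma>"
  from fun_cong[OF fun_cong[OF this]]
  have "operation H x y = gamma_operation G \<gamma> x y" for x y .
  then show "\<forall>x\<in>carrier G. \<forall>y\<in>carrier G. x \<otimes>\<^bsub>H\<^esub> y = \<gamma> y x \<otimes>\<^bsub>G\<^esub> y"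
    by (metis (no_types, lifting) assms gamma_operation_def operation_def restrict_apply')
qed (auto simp: operation_def gamma_operation_def carrier intro!: restrict_ext)

lemma gamma_function_auto:
  "gamma_function G \<gamma> \<Longrightarrow> x \<in> carrier G \<Longrightarrow> \<gamma> x \<in> auto G"
  by (auto simp: gamma_function_def)

lemma gamma_function_apply:
  assumes "gamma_function G \<gamma>" "g \<in> carrier G" "h \<in> carrier G" "x \<in> carrier G"
  shows "\<gamma> (\<gamma> h g \<otimes> h) x = \<gamma> h (\<gamma> g x)"
  using assms gamma_function_apply_iff[of \<gamma>] by (simp add: gamma_function_def)

text \<open>The gamma law at \<one>, \<one> makes \<open>\<gamma> \<one>\<close> idempotent, and an
  idempotent permutation is the identity.\<close>

lemma gamma_function_one:
  assumes \<gamma>: "gamma_function G \<gamma>" and x: "x \<in> carrier G"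
  shows "\<gamma> \<one> x = x"
proof -
  have A: "\<gamma> \<one> \<in> auto G" using \<gamma> by (rule gamma_function_auto) simp
  have "\<gamma> \<one> x = \<gamma> \<one> (\<gamma> \<one> x)"
    using gamma_function_apply[OF \<gamma> one_closed one_closed x] A by (simp add: auto_one)
  then show ?thesis
    using Bij_eq_iff[OF x auto_mem[OF A x] auto_Bij[OF A]] by simp
qed

text \<open>Associativity of the circle operation comes from the gamma law and the multiplicativity
  of each \<open>\<gamma> z\<close>; this multiplicativity alone gives the skew brace law. A left
  inverse of \<open>y\<close> is the preimage of \<open>inv y\<close> under
  \<open>\<gamma> y\<close>.\<close>

lemma skew_brace_of_gamma_function:
  assumes \<gamma>: "gamma_function G \<gamma>"
  obtains H :: "'a monoid" where "skew_brace G H" "operation H = gamma_operation G \<gamma>"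
proof -
  define H :: "'a monoid" where "H = \<lparr>carrier = carrier G, mult = (\<lambda>x y. \<gamma> y x \<otimes> y), one = \<one>\<rparr>"
  note A = gamma_function_auto[OF \<gamma>] auto_mem[OF gamma_function_auto[OF \<gamma>]]
    auto_mult[OF gamma_function_auto[OF \<gamma>]]
  have "group H"
  proof (rule groupI)
    fix x y z assume "x \<in> carrier H" "y \<in> carrier H" "z \<in> carrier H"
    then show "x \<otimes>\<^bsub>H\<^esub> y \<otimes>\<^bsub>H\<^esub> z = x \<otimes>\<^bsub>H\<^esub> (y \<otimes>\<^bsub>H\<^esub> z)"
      using A by (simp add: H_def gamma_function_apply[OF \<gamma>] m_assoc)
  next
    fix y assume "y \<in> carrier H"
    then have y: "y \<in> carrier G" by (simp add: H_def)
    obtain x where "x \<in> carrier G" "\<gamma> y x = inv y"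
      using auto_inv_apply[OF A(1)[OF y] inv_closed[OF y]] .
    then show "\<exists>x\<in>carrier H. x \<otimes>\<^bsub>H\<^esub> y = \<one>\<^bsub>H\<^esub>"
      using y by (intro bexI[where x = x]) (simp_all add: H_def)
  qed (use A in \<open>auto simp: H_def auto_one\<close>)
  moreover have "\<gamma> z (x \<otimes> y) \<otimes> z = \<gamma> z x \<otimes> z \<otimes> inv z \<otimes> (\<gamma> z y \<otimes> z)"
    if "x \<in> carrier G" "y \<in> carrier G" "z \<in> carrier G" for x y z
    using that A by (simp add: inv_solve_right' m_assoc[symmetric]) (simp add: m_assoc)
  ultimately have "skew_brace G H"
    by (simp add: skew_brace_def H_def group_axioms)
  moreover have "operation H = gamma_operation G \<gamma>"
    by (subst operation_eq_iff) (simp_all add: H_def)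
  ultimately show thesis by (rule that)
qed

lemma skew_brace_distrib:
  assumes "skew_brace G H" "x \<in> carrier G" "y \<in> carrier G" "z \<in> carrier G"
  shows "(x \<otimes> y) \<otimes>\<^bsub>H\<^esub> z = (x \<otimes>\<^bsub>H\<^esub> z) \<otimes> inv z \<otimes> (y \<otimes>\<^bsub>H\<^esub> z)"
  using assms by (simp add: skew_brace_def)

lemma skew_brace_one:
  assumes H: "skew_brace G H"
  shows "\<one>\<^bsub>H\<^esub> = \<one>"
proof -
  interpret H: group H using H by (simp add: skew_brace_def)
  have carrier: "carrier H = carrier G" using H by (simp add: skew_brace_def)
  have z: "\<one>\<^bsub>H\<^esub> \<in> carrier G" using H.one_closed carrier by simp
  \<comment> \<open>In the skew brace law with both summands \<one> and \<open>z\<close> the circle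
    identity, the left side is \<one> and the right side is the additive inverse of
    \<open>z\<close>.\<close>
  have "\<one> = \<one> \<otimes>\<^bsub>H\<^esub> \<one>\<^bsub>H\<^esub>" using carrier by simp
  then have "inv \<one>\<^bsub>H\<^esub> = \<one>"
    using skew_brace_distrib[OF H one_closed one_closed z] z by simp
  then show ?thesis using z by simp
qed

text \<open>\<open>\<gamma> y\<close> is right circle multiplication by \<open>y\<close> followed by
  the translation by \<open>inv y\<close>, so it is bijective. The skew brace law says that it is
  multiplicative, and associativity of the circle operation gives the gamma law.\<close>

lemma gamma_function_of_skew_brace:
  assumes H: "skew_brace G H"
  obtains \<gamma> where "gamma_function G \<gamma>" "operation H = gamma_operation G \<gamma>"
proof -
  interpret H: group H using H by (simp add: skew_brace_def)
  have carrier: "carrier H = carrier G" using H by (simp add: skew_brace_def)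
  have closed: "x \<otimes>\<^bsub>H\<^esub> y \<in> carrier G" if "x \<in> carrier G" "y \<in> carrier G" for x y
    using H.m_closed that carrier by simp
  have inv_closed_H: "inv\<^bsub>H\<^esub> x \<in> carrier G" if "x \<in> carrier G" for x
    using H.inv_closed that carrier by simp
  define \<gamma> where "\<gamma> = (\<lambda>y\<in>carrier G. \<lambda>x\<in>carrier G. (x \<otimes>\<^bsub>H\<^esub> y) \<otimes> inv y)"
  have \<gamma>_apply: "\<gamma> y x = (x \<otimes>\<^bsub>H\<^esub> y) \<otimes> inv y" if "x \<in> carrier G" "y \<in> carrier G" for x y
    using that by (simp add: \<gamma>_def)
  have \<gamma>_op: "\<gamma> y x \<otimes> y = x \<otimes>\<^bsub>H\<^esub> y" if "x \<in> carrier G" "y \<in> carrier G" for x y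
    using that by (simp add: \<gamma>_apply closed m_assoc)
  have auto: "\<gamma> y \<in> auto G" if y: "y \<in> carrier G" for y
  proof -
    have "\<gamma> y \<in> Bij (carrier G)"
    proof (rule BijI[where g = "\<lambda>x. (x \<otimes> y) \<otimes>\<^bsub>H\<^esub> inv\<^bsub>H\<^esub> y"])
      show "\<gamma> y \<in> extensional (carrier G)" using y by (simp add: \<gamma>_def)
    next
      fix x assume x: "x \<in> carrier G"
      show "\<gamma> y x \<in> carrier G" "(x \<otimes> y) \<otimes>\<^bsub>H\<^esub> inv\<^bsub>H\<^esub> y \<in> carrier G"
        using x y by (simp_all add: \<gamma>_apply closed inv_closed_H)
      show "(\<gamma> y x \<otimes> y) \<otimes>\<^bsub>H\<^esub> inv\<^bsub>H\<^esub> y = x"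
        using x y carrier by (simp add: \<gamma>_op H.m_assoc inv_closed_H)
      show "\<gamma> y ((x \<otimes> y) \<otimes>\<^bsub>H\<^esub> inv\<^bsub>H\<^esub> y) = x"
        using x y carrier by (simp add: \<gamma>_apply closed inv_closed_H H.m_assoc m_assoc)
    qed
    moreover have "\<gamma> y (u \<otimes> v) = \<gamma> y u \<otimes> \<gamma> y v" if "u \<in> carrier G" "v \<in> carrier G" for u v
      using that y by (simp add: \<gamma>_apply skew_brace_distrib[OF H] closed m_assoc)
    ultimately show ?thesis
      by (auto simp: auto_def hom_def intro: Bij_mem)
  qed
  have "\<gamma> (\<gamma> h g \<otimes> h) x = \<gamma> h (\<gamma> g x)"
    if g: "g \<in> carrier G" and h: "h \<in> carrier G" and x: "x \<in> carrier G" for g h x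
  proof -
    have "\<gamma> h (\<gamma> g x) = \<gamma> h (x \<otimes>\<^bsub>H\<^esub> g) \<otimes> inv (\<gamma> h g)"
      using g h x auto by (simp add: \<gamma>_apply[of x g] closed auto_mult auto_inv)
    \<comment> \<open>Expanding both values of \<open>\<gamma> h\<close> produces a factor
      \<open>inv h\<close> and a factor \<open>h\<close> next to each other, which cancel.\<close>
    also have "\<dots> = (x \<otimes>\<^bsub>H\<^esub> g \<otimes>\<^bsub>H\<^esub> h) \<otimes> inv (g \<otimes>\<^bsub>H\<^esub> h)"
      using g h x by (simp add: \<gamma>_apply closed inv_mult_group m_assoc) (simp add: closed flip: m_assoc)
    also have "\<dots> = \<gamma> (g \<otimes>\<^bsub>H\<^esub> h) x"
      using g h x carrier by (simp add: \<gamma>_apply closed H.m_assoc)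
    finally show ?thesis using g h by (simp add: \<gamma>_op)
  qed
  moreover have "\<gamma> \<in> carrier G \<rightarrow>\<^sub>E auto G" using auto by (auto simp: \<gamma>_def)
  ultimately have "gamma_function G \<gamma>" by (simp add: gamma_function_apply_iff)
  moreover have "operation H = gamma_operation G \<gamma>"
    using carrier \<gamma>_op by (simp add: operation_eq_iff)
  ultimately show thesis by (rule that)
qed

text \<open>Cancelling \<open>y\<close> in \<open>\<gamma> y x \<otimes> y\<close> recovers
  \<open>\<gamma>\<close> on the carrier; extensionality of \<open>\<gamma>\<close> and of its
  values settles the rest. The image is determined by the two preceding constructions.\<close>

lemma bij_betw_gamma_operation:
  "bij_betw (gamma_operation G) {\<gamma>. gamma_function G \<gamma>} (skew_brace_operations G)"
  unfolding bij_betw_def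
proof
  show "inj_on (gamma_operation G) {\<gamma>. gamma_function G \<gamma>}"
  proof (rule inj_onI)
    fix \<gamma> \<delta> assume "\<gamma> \<in> {\<gamma>. gamma_function G \<gamma>}" "\<delta> \<in> {\<gamma>. gamma_function G \<gamma>}"
      and eq: "gamma_operation G \<gamma> = gamma_operation G \<delta>"
    then have \<gamma>: "gamma_function G \<gamma>" and \<delta>: "gamma_function G \<delta>" by auto
    have "\<gamma> y = \<delta> y" if y: "y \<in> carrier G" for y
    proof (rule Bij_eqI[where S = "carrier G"])
      fix x assume x: "x \<in> carrier G"
      then have "\<gamma> y x \<otimes> y = \<delta> y x \<otimes> y"
        using y fun_cong[OF fun_cong[OF eq, of x], of y] by (simp add: gamma_operation_def)
      then show "\<gamma> y x = \<delta> y x"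
        using x y auto_mem gamma_function_auto \<gamma> \<delta> by simp
    qed (use y \<gamma> \<delta> auto_Bij gamma_function_auto in blast)+
    then show "\<gamma> = \<delta>"
      using \<gamma> \<delta> unfolding gamma_function_def by (metis (no_types, lifting) PiE_ext)
  qed
  show "gamma_operation G ` {\<gamma>. gamma_function G \<gamma>} = skew_brace_operations G"
  proof (intro equalityI subsetI)
    fix p assume "p \<in> gamma_operation G ` {\<gamma>. gamma_function G \<gamma>}"
    then obtain \<gamma> where "gamma_function G \<gamma>" "p = gamma_operation G \<gamma>" by blast
    then show "p \<in> skew_brace_operations G"
      using skew_brace_of_gamma_function unfolding skew_brace_operations_def by (metis (mono_tags, lifting) mem_Collect_eq)
  next
    fix p assume "p \<in> skew_brace_operations G"
    then obtain H :: "'a monoid" where "skew_brace G H" "p = operation H"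
      by (auto simp: skew_brace_operations_def)
    then show "p \<in> gamma_operation G ` {\<gamma>. gamma_function G \<gamma>}"
      using gamma_function_of_skew_brace by blast
  qed
qed

section \<open>Regular subgroups of the holomorph\<close>

lemma gamma_mult_right_mult_apply:
  assumes "gamma_function G \<gamma>" "x \<in> carrier G" "y \<in> carrier G"
  shows "(\<gamma> y \<otimes>\<^bsub>perms\<^esub> right_mult G y) x = \<gamma> y x \<otimes> y"
proof -
  have "\<gamma> y \<in> auto G" using assms gamma_function_auto by blast
  then show ?thesis
    using assms auto_Bij auto_mem by (simp add: perm_group_apply right_mult_Bij right_mult_apply)
qed

lemma gamma_mult_right_mult_Bij:
  assumes "gamma_function G \<gamma>" "y \<in> carrier G"
  shows "\<gamma> y \<otimes>\<^bsub>perms\<^esub> right_mult G y \<in> Bij (carrier G)"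
  using assms auto_Bij gamma_function_auto perm_group_m_closed right_mult_Bij by blast

text \<open>Each \<gamma>(y)\<rho>(y) is the map x \<mapsto> x \<circ> y. Facts about the right
  translations of a group therefore apply to \<open>gamma_subgroup G \<gamma>\<close> through
  \<open>H\<close>.\<close>

lemma gamma_subgroup_eq_right_mults:
  assumes \<gamma>: "gamma_function G \<gamma>" and H: "skew_brace G H" and op: "operation H = gamma_operation G \<gamma>"
  shows "gamma_subgroup G \<gamma> = right_mult H ` carrier H"
proof -
  interpret H: group H using H by (simp add: skew_brace_def)
  have carrier: "carrier H = carrier G" using H by (simp add: skew_brace_def)
  have "\<gamma> y \<otimes>\<^bsub>perms\<^esub> right_mult G y = right_mult H y" if y: "y \<in> carrier G" for y
  proof (rule Bij_eqI[where S = "carrier G"])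
    show "right_mult H y \<in> Bij (carrier G)"
      using H.right_mult_Bij carrier y by simp
    show "\<gamma> y \<otimes>\<^bsub>perms\<^esub> right_mult G y \<in> Bij (carrier G)"
      using \<gamma> y by (rule gamma_mult_right_mult_Bij)
    fix x assume x: "x \<in> carrier G"
    then show "(\<gamma> y \<otimes>\<^bsub>perms\<^esub> right_mult G y) x = right_mult H y x"
      using op y carrier gamma_mult_right_mult_apply[OF \<gamma>]
      by (simp add: operation_eq_iff H.right_mult_apply)
  qed
  then show ?thesis
    by (simp add: gamma_subgroup_def carrier Setcompr_eq_image cong: image_cong_simp)
qed

text \<open>Regularity is that of the right translations of the circle group; membership in the
  holomorph holds because both factors of each element lie there.\<close>

lemma gamma_subgroup_regular_Hol:
  assumes \<gamma>: "gamma_function G \<gamma>"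
  shows "gamma_subgroup G \<gamma> \<in> regular_subgroups_Hol G"
proof -
  interpret P: group perms by (rule group_perm_group)
  interpret L: subgroup "carrier (Hol G)" perms by (rule subgroup_Hol)
  obtain H :: "'a monoid" where H: "skew_brace G H" and op: "operation H = gamma_operation G \<gamma>"
    using skew_brace_of_gamma_function[OF \<gamma>] .
  interpret H: group H using H by (simp add: skew_brace_def)
  have carrier: "carrier H = carrier G" using H by (simp add: skew_brace_def)
  have R: "regular (carrier G) (gamma_subgroup G \<gamma>)"
    using H.regular_right_mults gamma_subgroup_eq_right_mults[OF \<gamma> H op] carrier by simp
  have "gamma_subgroup G \<gamma> \<subseteq> carrier (Hol G)"
    using gamma_function_auto[OF \<gamma>] auto_subset_Hol right_mults_subset_Hol
    unfolding gamma_subgroup_def by (blast intro: L.m_closed)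
  then have "subgroup (gamma_subgroup G \<gamma>) (perms\<lparr>carrier := carrier (Hol G)\<rparr>)"
    using R subgroup_Hol by (intro P.subgroup_incl) (auto simp: regular_def)
  then show ?thesis
    using R by (simp add: regular_subgroups_Hol_def Hol_def)
qed

text \<open>Transitivity provides an element of \<open>N\<close> sending \<one> to any given
  \<open>y\<close>, and its automorphism part is taken as the value at \<open>y\<close>. Regularity
  makes \<open>\<nu> y\<close> the only such element, so that \<open>N\<close> is labelled by the
  carrier.\<close>

lemma regular_Hol_is_gamma_subgroup:
  assumes "N \<in> regular_subgroups_Hol G"
  obtains \<gamma> where "gamma_function G \<gamma>" "N = gamma_subgroup G \<gamma>"
proof -
  have R: "regular (carrier G) N" and "N \<subseteq> carrier (Hol G)"
    using assms subgroup.subset by (auto simp: regular_subgroups_Hol_def)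
  interpret N: subgroup N perms using R by (simp add: regular_def)
  have NB: "f \<in> Bij (carrier G)" if "f \<in> N" for f
    using that N.subset by (auto simp: perm_group_simps(1))
  have "\<exists>\<alpha>. \<alpha> \<in> auto G \<and> \<alpha> \<otimes>\<^bsub>perms\<^esub> right_mult G y \<in> N" if y: "y \<in> carrier G" for y
  proof -
    obtain f where "f \<in> N" "f \<one> = y" using R y one_closed unfolding regular_def by blast
    then show ?thesis using Hol_decomposition \<open>N \<subseteq> carrier (Hol G)\<close> by (metis subsetD)
  qed
  then obtain \<alpha> where \<alpha>: "\<alpha> y \<in> auto G" "\<alpha> y \<otimes>\<^bsub>perms\<^esub> right_mult G y \<in> N"
    if "y \<in> carrier G" for y by metis
  define \<gamma> where "\<gamma> = restrict \<alpha> (carrier G)"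
  define \<nu> where "\<nu> y = \<gamma> y \<otimes>\<^bsub>perms\<^esub> right_mult G y" for y
  have \<gamma>: "\<gamma> \<in> carrier G \<rightarrow>\<^sub>E auto G" using \<alpha> by (simp add: \<gamma>_def)
  have auto: "\<gamma> y \<in> auto G" if "y \<in> carrier G" for y using \<gamma> that by blast
  have \<nu>N: "\<nu> y \<in> N" if "y \<in> carrier G" for y using \<alpha> that by (simp add: \<nu>_def \<gamma>_def)
  have \<nu>: "\<nu> y x = \<gamma> y x \<otimes> y" if "x \<in> carrier G" "y \<in> carrier G" for x y
    using that auto auto_Bij auto_mem
    by (simp add: \<nu>_def perm_group_apply right_mult_Bij right_mult_apply)
  have \<nu>_one: "\<nu> y \<one> = y" if "y \<in> carrier G" for y
    using that auto by (simp add: \<nu> auto_one)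
  have "\<gamma> (\<gamma> h g \<otimes> h) x = \<gamma> h (\<gamma> g x)"
    if g: "g \<in> carrier G" and h: "h \<in> carrier G" and x: "x \<in> carrier G" for g h x
  proof -
    let ?w = "\<gamma> h g \<otimes> h"
    have mem: "\<gamma> h g \<in> carrier G" "\<gamma> g x \<in> carrier G" "?w \<in> carrier G"
      using g h x auto auto_mem by auto
    have gx: "\<gamma> h (\<gamma> g x) \<in> carrier G" "\<gamma> ?w x \<in> carrier G" using mem h x auto auto_mem by auto
    \<comment> \<open>Both sides lie in \<open>N\<close> and send \<one> to \<open>?w\<close>. Once
      they are equal, evaluating at \<open>x\<close> and cancelling \<open>?w\<close> gives the
      gamma law.\<close>
    have "\<nu> ?w = \<nu> g \<otimes>\<^bsub>perms\<^esub> \<nu> h"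
    proof (rule regular_unique[OF R])
      show "\<nu> ?w \<one> = (\<nu> g \<otimes>\<^bsub>perms\<^esub> \<nu> h) \<one>"
        using g h mem NB \<nu>N by (simp add: perm_group_apply \<nu>_one \<nu>[OF g h])
    qed (use g h mem \<nu>N in auto)
    then have "\<nu> ?w x = \<nu> h (\<nu> g x)"
      using g h x NB \<nu>N by (simp add: perm_group_apply)
    then have "\<gamma> ?w x \<otimes> ?w = \<gamma> h (\<gamma> g x) \<otimes> ?w"
      using g h x mem auto gx by (simp add: \<nu> auto_mult m_assoc)
    then show ?thesis using mem gx by simp
  qed
  then have gf: "gamma_function G \<gamma>" by (simp add: gamma_function_apply_iff[OF \<gamma>])
  have "N = \<nu> ` carrier G"
  proof (intro equalityI subsetI)
    fix f assume f: "f \<in> N"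
    have y: "f \<one> \<in> carrier G" by (rule Bij_mem[OF NB[OF f] one_closed])
    have "f = \<nu> (f \<one>)"
      by (intro regular_unique[OF R f \<nu>N[OF y] one_closed]) (simp add: \<nu>_one[OF y])
    then show "f \<in> \<nu> ` carrier G" using y by blast
  qed (use \<nu>N in auto)
  then have "N = gamma_subgroup G \<gamma>" unfolding gamma_subgroup_def \<nu>_def by blast
  with gf show thesis by (rule that)
qed

lemma bij_betw_gamma_subgroup:
  "bij_betw (gamma_subgroup G) {\<gamma>. gamma_function G \<gamma>} (regular_subgroups_Hol G)"
  unfolding bij_betw_def
proof
  show "inj_on (gamma_subgroup G) {\<gamma>. gamma_function G \<gamma>}"
  proof (rule inj_onI)
    fix \<gamma> \<delta> assume "\<gamma> \<in> {\<gamma>. gamma_function G \<gamma>}" "\<delta> \<in> {\<gamma>. gamma_function G \<gamma>}"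
      and eq: "gamma_subgroup G \<gamma> = gamma_subgroup G \<delta>"
    then have \<gamma>: "gamma_function G \<gamma>" and \<delta>: "gamma_function G \<delta>" by auto
    have "\<gamma> y = \<delta> y" if y: "y \<in> carrier G" for y
    proof -
      have "\<gamma> y \<otimes>\<^bsub>perms\<^esub> right_mult G y \<in> gamma_subgroup G \<delta>"
        using y eq unfolding gamma_subgroup_def by blast
      then obtain z where z: "z \<in> carrier G"
        and *: "\<gamma> y \<otimes>\<^bsub>perms\<^esub> right_mult G y = \<delta> z \<otimes>\<^bsub>perms\<^esub> right_mult G z"
        unfolding gamma_subgroup_def by blast
      \<comment> \<open>Automorphisms fix \<one>, so evaluation there reads off the translation
        part, which can then be cancelled.\<close>
      have "y = z"
        using fun_cong[OF *, of \<one>] y z gamma_function_auto[OF \<gamma> y] gamma_function_auto[OF \<delta> z]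
        by (simp add: gamma_mult_right_mult_apply \<gamma> \<delta> auto_one)
      then show ?thesis
        using * y \<gamma> \<delta> auto_Bij gamma_function_auto right_mult_Bij
        by (metis group.right_cancel group_perm_group perm_group_simps(1))
    qed
    then show "\<gamma> = \<delta>"
      using \<gamma> \<delta> unfolding gamma_function_def by (metis (no_types, lifting) PiE_ext)
  qed
  show "gamma_subgroup G ` {\<gamma>. gamma_function G \<gamma>} = regular_subgroups_Hol G"
    using gamma_subgroup_regular_Hol regular_Hol_is_gamma_subgroup by blast
qed

subsection \<open>Invariance under automorphisms\<close>

text \<open>For \<open>\<beta>\<close> in \<open>auto G\<close>, the images of x \<circ> y and the
  circle product of the images both end in the factor \<open>\<beta> y\<close>. Cancelling it turns
  preservation of the circle operation into the pointwise form of equivariance.\<close>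

lemma auto_subset_iff_equivariant:
  assumes \<gamma>: "gamma_function G \<gamma>" and H: "skew_brace G H" and op: "operation H = gamma_operation G \<gamma>"
  shows "auto G \<subseteq> auto H \<longleftrightarrow> gamma_equivariant G \<gamma>"
proof -
  interpret H: group H using H by (simp add: skew_brace_def)
  have carrier: "carrier H = carrier G" using H by (simp add: skew_brace_def)
  have mult: "x \<otimes>\<^bsub>H\<^esub> y = \<gamma> y x \<otimes> y" if "x \<in> carrier G" "y \<in> carrier G" for x y
    using op carrier that by (simp add: operation_eq_iff)
  have PiE: "\<gamma> \<in> carrier G \<rightarrow>\<^sub>E auto G" using \<gamma> by (simp add: gamma_function_def)
  have "\<beta> \<in> auto H \<longleftrightarrow> (\<forall>y\<in>carrier G. \<forall>x\<in>carrier G. \<gamma> (\<beta> y) (\<beta> x) = \<beta> (\<gamma> y x))"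
    if \<beta>: "\<beta> \<in> auto G" for \<beta>
  proof -
    have "\<beta> \<in> auto H \<longleftrightarrow>
        (\<forall>x\<in>carrier G. \<forall>y\<in>carrier G. \<beta> (x \<otimes>\<^bsub>H\<^esub> y) = \<beta> x \<otimes>\<^bsub>H\<^esub> \<beta> y)"
      using \<beta> carrier by (auto simp: auto_def hom_def)
    also have "\<dots> \<longleftrightarrow> (\<forall>x\<in>carrier G. \<forall>y\<in>carrier G. \<beta> (\<gamma> y x) = \<gamma> (\<beta> y) (\<beta> x))"
      using \<beta> auto_mem gamma_function_auto[OF \<gamma>] by (simp add: mult auto_mult)
    finally show ?thesis by metis
  qed
  then show ?thesis
    unfolding gamma_equivariant_apply_iff[OF PiE] by blast
qed

text \<open>The two groups share their identity, which every automorphism of \<open>G\<close> fixes.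
  In the description of \<open>auto H\<close> as a stabiliser inside a normaliser, only the
  normaliser condition then remains.\<close>

lemma auto_subset_iff_normalizer:
  assumes H: "skew_brace G H"
  shows "auto G \<subseteq> auto H \<longleftrightarrow> auto G \<subseteq> normalizer perms (right_mult H ` carrier H)"
proof -
  interpret H: group H using H by (simp add: skew_brace_def)
  have carrier: "carrier H = carrier G" using H by (simp add: skew_brace_def)
  show ?thesis
    using H.auto_iff_normalizer auto_one skew_brace_one[OF H] carrier by auto
qed

text \<open>Since \<open>\<rho>(y) = \<gamma>(y)\<^sup>-\<^sup>1 \<cdot> \<gamma>(y)\<rho>(y)\<close>, a subgroup
  containing \<open>Aut(G)\<close> and \<open>N\<close> contains the translations, hence all of \<open>Hol(G)\<close>.\<close>

lemma normal_Hol_iff_auto_normalizer: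
  assumes \<gamma>: "gamma_function G \<gamma>"
  shows "gamma_subgroup G \<gamma> \<lhd> Hol G \<longleftrightarrow> auto G \<subseteq> normalizer perms (gamma_subgroup G \<gamma>)"
proof -
  let ?N = "gamma_subgroup G \<gamma>"
  interpret P: group perms by (rule group_perm_group)
  have N: "subgroup ?N (Hol G)" "subgroup ?N perms"
    using gamma_subgroup_regular_Hol[OF \<gamma>] by (auto simp: regular_subgroups_Hol_def regular_def)
  interpret M: subgroup "normalizer perms ?N" perms
    using P.normalizer_imp_subgroup N(2) subgroup.subset by blast
  have "carrier (Hol G) \<subseteq> normalizer perms ?N" if A: "auto G \<subseteq> normalizer perms ?N"
  proof
    fix f assume "f \<in> carrier (Hol G)"
    then obtain \<alpha> where \<alpha>: "\<alpha> \<in> auto G" "f = \<alpha> \<otimes>\<^bsub>perms\<^esub> right_mult G (f \<one>)" and y: "f \<one> \<in> carrier G"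
      by (rule Hol_decomposition)
    let ?y = "f \<one>"
    have g: "\<gamma> ?y \<in> normalizer perms ?N" using A gamma_function_auto[OF \<gamma> y] by blast
    moreover have "\<gamma> ?y \<otimes>\<^bsub>perms\<^esub> right_mult G ?y \<in> normalizer perms ?N"
      using P.subgroup_subset_normalizer[OF N(2)] y by (auto simp: gamma_subgroup_def)
    ultimately have "inv\<^bsub>perms\<^esub> \<gamma> ?y \<otimes>\<^bsub>perms\<^esub> (\<gamma> ?y \<otimes>\<^bsub>perms\<^esub> right_mult G ?y) \<in> normalizer perms ?N"
      by blast
    moreover have "right_mult G ?y \<in> carrier perms" using right_mults_subset y by blast
    ultimately have "right_mult G ?y \<in> normalizer perms ?N"
      using g by (simp flip: P.m_assoc)
    then show "f \<in> normalizer perms ?N" using A \<alpha> by (metis M.m_closed subsetD)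
  qed
  then show ?thesis
    using normal_Hol_iff[OF N(1)] auto_subset_Hol by blast
qed

section \<open>Uniqueness within the isomorphism class\<close>

text \<open>The circle operation is pulled back along \<open>\<beta>\<close>. As
  \<open>\<beta>\<close> respects the additive operation too, the skew brace law is carried along
  with the group axioms.\<close>

lemma transport_skew_brace:
  assumes H: "skew_brace G H" and \<beta>: "\<beta> \<in> auto G"
  obtains H' :: "'a monoid" where "skew_brace G H'" "\<beta> \<in> skew_brace_iso G H' G H"
proof -
  interpret H: group H using H by (simp add: skew_brace_def)
  have carrier: "carrier H = carrier G" using H by (simp add: skew_brace_def)
  let ?\<beta>' = "inv\<^bsub>perms\<^esub> \<beta>"
  have B: "\<beta> \<in> Bij (carrier G)" "?\<beta>' \<in> Bij (carrier G)"
    using \<beta> auto_Bij perm_group_inv_closed by blast+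
  note mem = Bij_mem[OF B(1)] Bij_mem[OF B(2)]
  note inv = perm_group_inv_apply[OF B(1)]
  have closed: "x \<otimes>\<^bsub>H\<^esub> y \<in> carrier G" if "x \<in> carrier G" "y \<in> carrier G" for x y
    using H.m_closed that carrier by simp
  have one: "\<one>\<^bsub>H\<^esub> \<in> carrier G" using H.one_closed carrier by simp
  define H' :: "'a monoid" where
    "H' = \<lparr>carrier = carrier G, mult = (\<lambda>x y. ?\<beta>' (\<beta> x \<otimes>\<^bsub>H\<^esub> \<beta> y)), one = ?\<beta>' \<one>\<^bsub>H\<^esub>\<rparr>"
  have hom: "\<beta> (x \<otimes>\<^bsub>H'\<^esub> y) = \<beta> x \<otimes>\<^bsub>H\<^esub> \<beta> y" if "x \<in> carrier G" "y \<in> carrier G" for x y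
    using that by (simp add: H'_def inv closed mem)
  have closed': "x \<otimes>\<^bsub>H'\<^esub> y \<in> carrier G" if "x \<in> carrier G" "y \<in> carrier G" for x y
    using that by (simp add: H'_def closed mem)
  \<comment> \<open>Injectivity of \<open>\<beta>\<close> allows associativity and the skew brace
    law for \<open>H'\<close> to be checked after applying \<open>\<beta>\<close>, where they become
    identities in \<open>H\<close>.\<close>
  have cancel: "x = y" if "\<beta> x = \<beta> y" "x \<in> carrier G" "y \<in> carrier G" for x y
    using that Bij_eq_iff B by metis
  have "group H'"
  proof (rule groupI)
    fix x y z assume "x \<in> carrier H'" "y \<in> carrier H'" "z \<in> carrier H'"
    then have "x \<in> carrier G" "y \<in> carrier G" "z \<in> carrier G" by (simp_all add: H'_def)
    then show "x \<otimes>\<^bsub>H'\<^esub> y \<otimes>\<^bsub>H'\<^esub> z = x \<otimes>\<^bsub>H'\<^esub> (y \<otimes>\<^bsub>H'\<^esub> z)"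
      using mem carrier by - (rule cancel, simp_all add: hom closed' H.m_assoc)
  next
    fix x assume "x \<in> carrier H'"
    then have x: "x \<in> carrier G" by (simp add: H'_def)
    then show "\<one>\<^bsub>H'\<^esub> \<otimes>\<^bsub>H'\<^esub> x = x"
      using mem carrier one by (simp add: H'_def inv)
    have "inv\<^bsub>H\<^esub> \<beta> x \<in> carrier G" using x mem carrier H.inv_closed by metis
    then show "\<exists>y\<in>carrier H'. y \<otimes>\<^bsub>H'\<^esub> x = \<one>\<^bsub>H'\<^esub>"
      using x mem carrier by (intro bexI[where x = "?\<beta>' (inv\<^bsub>H\<^esub> \<beta> x)"]) (simp_all add: H'_def inv)
  qed (use closed' mem one in \<open>auto simp: H'_def\<close>)
  moreover have "(x \<otimes> y) \<otimes>\<^bsub>H'\<^esub> z = (x \<otimes>\<^bsub>H'\<^esub> z) \<otimes> inv z \<otimes> (y \<otimes>\<^bsub>H'\<^esub> z)"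
    if "x \<in> carrier G" "y \<in> carrier G" "z \<in> carrier G" for x y z
    using that \<beta> mem
    by - (rule cancel, simp_all add: hom closed' auto_mult auto_inv skew_brace_distrib[OF H])
  ultimately have "skew_brace G H'"
    by (simp add: skew_brace_def group_axioms) (simp add: H'_def)
  moreover have "\<beta> \<in> skew_brace_iso G H' G H"
  proof -
    have "bij_betw \<beta> (carrier G) (carrier G)" "\<beta> \<in> hom G G"
      using \<beta> by (auto simp: auto_def Bij_def)
    moreover have "\<beta> \<in> hom H' H"
      using hom mem carrier by (auto simp: hom_def H'_def)
    ultimately show ?thesis using carrier by (simp add: skew_brace_iso_def iso_def H'_def)
  qed
  ultimately show thesis by (rule that)
qed

text \<open>An isomorphism between two skew braces on \<open>G\<close> is in particular an
  automorphism of \<open>G\<close>; if it also preserves the circle operation of the target, the two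
  operations agree. Conversely, uniqueness forces the operation transported along
  \<open>\<beta>\<close> to be the original one, so \<open>\<beta>\<close> preserves it.\<close>

lemma auto_subset_iff_unique:
  fixes H :: "'a monoid"
  assumes H: "skew_brace G H"
  shows "auto G \<subseteq> auto H \<longleftrightarrow> unique_of_iso_type G H"
proof
  have carrier: "carrier H = carrier G" using H by (simp add: skew_brace_def)
  assume sub: "auto G \<subseteq> auto H"
  show "unique_of_iso_type G H"
    unfolding unique_of_iso_type_def
  proof (intro allI impI, elim conjE)
    fix H' :: "'a monoid"
    assume H': "skew_brace G H'" and "skew_brace_iso G H' G H \<noteq> {}"
    then obtain f where f: "f \<in> iso G G" "f \<in> iso H' H" by (auto simp: skew_brace_iso_def)
    interpret H': group H' using H' by (simp add: skew_brace_def)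
    interpret H: group H using H by (simp add: skew_brace_def)
    have carrier': "carrier H' = carrier G" using H' by (simp add: skew_brace_def)
    \<comment> \<open>Members of \<open>iso\<close> may take any values off the carrier, whereas
      those of \<open>auto\<close> are extensional.\<close>
    have "restrict f (carrier G) \<in> auto G"
      using f(1) by (auto simp: auto_def iso_def hom_def Bij_def Pi_iff)
    then have "restrict f (carrier G) \<in> auto H" using sub by blast
    then have *: "f (x \<otimes>\<^bsub>H\<^esub> y) = f x \<otimes>\<^bsub>H\<^esub> f y" if "x \<in> carrier G" "y \<in> carrier G" for x y
      using that carrier H.m_closed[of x y] H.auto_mult[of _ x y] by fastforce
    have "x \<otimes>\<^bsub>H'\<^esub> y = x \<otimes>\<^bsub>H\<^esub> y" if x: "x \<in> carrier G" and y: "y \<in> carrier G" for x y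
    proof (rule inj_onD[of f "carrier G"])
      show "inj_on f (carrier G)" using f(1) by (simp add: iso_def bij_betw_def)
      show "f (x \<otimes>\<^bsub>H'\<^esub> y) = f (x \<otimes>\<^bsub>H\<^esub> y)"
        using f(2) * x y carrier' by (simp add: iso_def hom_def)
      show "x \<otimes>\<^bsub>H'\<^esub> y \<in> carrier G" "x \<otimes>\<^bsub>H\<^esub> y \<in> carrier G"
        using x y carrier carrier' H.m_closed[of x y] H'.m_closed[of x y] by auto
    qed
    then show "operation H' = operation H"
      unfolding operation_def carrier carrier' by (auto intro!: restrict_ext)
  qed
next
  have carrier: "carrier H = carrier G" using H by (simp add: skew_brace_def)
  assume uniq: "unique_of_iso_type G H"
  show "auto G \<subseteq> auto H"
  proof
    fix \<beta> assume \<beta>: "\<beta> \<in> auto G"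
    obtain H' :: "'a monoid" where H': "skew_brace G H'" and iso: "\<beta> \<in> skew_brace_iso G H' G H"
      using transport_skew_brace[OF H \<beta>] .
    have carrier': "carrier H' = carrier G" using H' by (simp add: skew_brace_def)
    have op: "operation H' = operation H" using uniq H' iso by (auto simp: unique_of_iso_type_def)
    have "x \<otimes>\<^bsub>H'\<^esub> y = x \<otimes>\<^bsub>H\<^esub> y" if "x \<in> carrier G" "y \<in> carrier G" for x y
      using fun_cong[OF fun_cong[OF op, of x], of y] that carrier carrier' by (simp add: operation_def)
    then have "\<beta> \<in> hom H H"
      using iso carrier carrier' by (auto simp: skew_brace_iso_def iso_def hom_def Pi_iff)
    then show "\<beta> \<in> auto H"
      using auto_Bij[OF \<beta>] carrier by (simp add: auto_def)
  qed
qed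

section \<open>The bi-skew brace property\<close>

lemma bi_skew_brace_if_auto_subset:
  assumes H: "skew_brace G H" and sub: "auto G \<subseteq> auto H"
  shows "bi_skew_brace G H"
proof -
  obtain \<gamma> where \<gamma>: "gamma_function G \<gamma>" and op: "operation H = gamma_operation G \<gamma>"
    using gamma_function_of_skew_brace[OF H] .
  interpret H: group H using H by (simp add: skew_brace_def)
  have carrier: "carrier H = carrier G" using H by (simp add: skew_brace_def)
  have mult: "x \<otimes>\<^bsub>H\<^esub> y = \<gamma> y x \<otimes> y" if "x \<in> carrier G" "y \<in> carrier G" for x y
    using op carrier that by (simp add: operation_eq_iff)
  have PiE: "\<gamma> \<in> carrier G \<rightarrow>\<^sub>E auto G" using \<gamma> by (simp add: gamma_function_def)
  have "gamma_antihom G \<gamma>"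
    using equivariant_gamma_function_iff_antihom[OF PiE] auto_subset_iff_equivariant[OF \<gamma> H op] sub \<gamma>
    by blast
  then have anti: "\<gamma> (x \<otimes> y) u = \<gamma> x (\<gamma> y u)"
    if "x \<in> carrier G" "y \<in> carrier G" "u \<in> carrier G" for x y u
    using that by (simp add: gamma_antihom_apply_iff[OF PiE])
  note A = gamma_function_auto[OF \<gamma>]
  have mem: "\<gamma> y x \<in> carrier G" if "x \<in> carrier G" "y \<in> carrier G" for x y
    using that A auto_mem by blast
  have "(x \<otimes>\<^bsub>H\<^esub> y) \<otimes> z = (x \<otimes> z) \<otimes>\<^bsub>H\<^esub> inv\<^bsub>H\<^esub> z \<otimes>\<^bsub>H\<^esub> (y \<otimes> z)"
    if x: "x \<in> carrier G" and y: "y \<in> carrier G" and z: "z \<in> carrier G" for x y z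
  proof -
    define z' where "z' = inv\<^bsub>H\<^esub> z"
    have z': "z' \<in> carrier G" using z carrier H.inv_closed[of z] by (simp add: z'_def)
    have "z' \<otimes>\<^bsub>H\<^esub> z = \<one>" using z carrier skew_brace_one[OF H] by (simp add: z'_def)
    \<comment> \<open>The equation z' \<circ> z = \<one> reads
      \<open>\<gamma> z z' \<otimes> z = \<one>\<close>.\<close>
    then have \<gamma>z': "\<gamma> z z' = inv z"
      using z z' mem inv_equality[of "\<gamma> z z'" z] by (simp add: mult)
    define w where "w = z' \<otimes>\<^bsub>H\<^esub> (y \<otimes> z)"
    have w: "w = inv (\<gamma> y z) \<otimes> y \<otimes> z"
      using y z z' by (simp add: w_def mult anti \<gamma>z' auto_inv A mem m_assoc)
    have w_mem: "w \<in> carrier G" using w y z mem by simp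
    have \<gamma>w: "\<gamma> w u = \<gamma> y u" if u: "u \<in> carrier G" for u
    proof -
      \<comment> \<open>The gamma law splits the circle product \<open>w\<close> and the
        antihomomorphism law splits \<open>y \<otimes> z\<close>. The values at \<open>z'\<close>
        and \<open>z\<close> then meet and compose to \<open>\<gamma> \<one>\<close>, leaving only
        \<open>\<gamma> y\<close>.\<close>
      have "\<gamma> w u = \<gamma> (y \<otimes> z) (\<gamma> z' u)"
        using y z z' u gamma_function_apply[OF \<gamma>] by (simp add: w_def mult)
      also have "\<dots> = \<gamma> y (\<gamma> z (\<gamma> z' u))"
        using y z z' u by (simp add: anti mem)
      also have "\<gamma> z (\<gamma> z' u) = \<gamma> (z' \<otimes>\<^bsub>H\<^esub> z) u"
        using z z' u gamma_function_apply[OF \<gamma>] by (simp add: mult)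
      also have "\<dots> = u" using \<open>z' \<otimes>\<^bsub>H\<^esub> z = \<one>\<close> u gamma_function_one[OF \<gamma>] by simp
      finally show ?thesis .
    qed
    have "(x \<otimes> z) \<otimes>\<^bsub>H\<^esub> inv\<^bsub>H\<^esub> z \<otimes>\<^bsub>H\<^esub> (y \<otimes> z) = (x \<otimes> z) \<otimes>\<^bsub>H\<^esub> w"
      using x y z z' carrier by (simp add: w_def H.m_assoc flip: z'_def)
    \<comment> \<open>Since \<open>\<gamma> w\<close> acts as the automorphism
      \<open>\<gamma> y\<close>, it splits the product \<open>x \<otimes> z\<close>; the factor
      \<open>\<gamma> y z\<close> so produced cancels against the first factor of
      \<open>w\<close>.\<close>
    also have "\<dots> = \<gamma> y x \<otimes> \<gamma> y z \<otimes> (inv (\<gamma> y z) \<otimes> y \<otimes> z)"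
      using x y z w_mem A by (simp add: mult \<gamma>w auto_mult) (simp add: w)
    also have "\<dots> = (\<gamma> y x \<otimes> y) \<otimes> z"
      using x y z mem by (simp add: m_assoc inv_solve_left) (simp flip: m_assoc)
    finally show ?thesis using x y by (simp add: mult)
  qed
  then have "skew_brace H G"
    using carrier by (simp add: skew_brace_def group_axioms H.group_axioms)
  with H show ?thesis by (simp add: bi_skew_brace_def)
qed

end

theorem theorem3p4:
  fixes G :: "('a, 'b) monoid_scheme"
  assumes "group G"
  shows
    "bij_betw (gamma_operation G) {\<gamma>. gamma_function G \<gamma>} (skew_brace_operations G)
   \<and> bij_betw (gamma_subgroup G) {\<gamma>. gamma_function G \<gamma>} (regular_subgroups_Hol G)
   \<and> (\<forall>\<gamma> (H :: 'a monoid).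
        gamma_function G \<gamma> \<and> skew_brace G H \<and> operation H = gamma_operation G \<gamma>
        \<longrightarrow> gamma_subgroup G \<gamma> = right_mult H ` carrier H)
   \<and> (\<forall>(H :: 'a monoid) N \<gamma>.
        skew_brace G H \<and> N \<in> regular_subgroups_Hol G \<and> gamma_function G \<gamma>
        \<and> operation H = gamma_operation G \<gamma> \<and> N = gamma_subgroup G \<gamma>
        \<longrightarrow> (auto G \<subseteq> auto H \<longleftrightarrow> unique_of_iso_type G H)
          \<and> (unique_of_iso_type G H \<longleftrightarrow> N \<lhd> Hol G)
          \<and> (N \<lhd> Hol G \<longleftrightarrow> auto G \<subseteq> normalizer (perm_group (carrier G)) N)
          \<and> (auto G \<subseteq> normalizer (perm_group (carrier G)) N \<longleftrightarrow> gamma_equivariant G \<gamma>)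
          \<and> (gamma_equivariant G \<gamma> \<longleftrightarrow> gamma_antihom G \<gamma> \<and> gamma_equivariant G \<gamma>))
   \<and> (\<forall>\<gamma> \<in> carrier G \<rightarrow>\<^sub>E auto G.
        gamma_function G \<gamma> \<and> gamma_equivariant G \<gamma>
        \<longleftrightarrow> gamma_antihom G \<gamma> \<and> gamma_equivariant G \<gamma>)
   \<and> (\<forall>H :: 'a monoid. skew_brace G H \<and> auto G \<subseteq> auto H \<longrightarrow> bi_skew_brace G H)"
proof -
  interpret group G by fact
  have equiv: "(auto G \<subseteq> auto H \<longleftrightarrow> unique_of_iso_type G H)
      \<and> (unique_of_iso_type G H \<longleftrightarrow> N \<lhd> Hol G)
      \<and> (N \<lhd> Hol G \<longleftrightarrow> auto G \<subseteq> normalizer perms N)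
      \<and> (auto G \<subseteq> normalizer perms N \<longleftrightarrow> gamma_equivariant G \<gamma>)
      \<and> (gamma_equivariant G \<gamma> \<longleftrightarrow> gamma_antihom G \<gamma> \<and> gamma_equivariant G \<gamma>)"
    if H: "skew_brace G H" and \<gamma>: "gamma_function G \<gamma>"
      and op: "operation H = gamma_operation G \<gamma>" and N: "N = gamma_subgroup G \<gamma>"
    for H :: "'a monoid" and N \<gamma>
  proof -
    have "\<gamma> \<in> carrier G \<rightarrow>\<^sub>E auto G" using \<gamma> by (simp add: gamma_function_def)
    then have "gamma_function G \<gamma> \<longleftrightarrow> gamma_antihom G \<gamma>" if "gamma_equivariant G \<gamma>"
      using that by (rule equivariant_gamma_function_iff_antihom)
    \<comment> \<open>\<open>N\<close> consists of the right translations of \<open>H\<close>, so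
      the description of \<open>auto H\<close> by a normaliser applies to it.\<close>
    moreover have "auto G \<subseteq> auto H \<longleftrightarrow> auto G \<subseteq> normalizer perms N"
      using auto_subset_iff_normalizer[OF H] gamma_subgroup_eq_right_mults[OF \<gamma> H op] N by simp
    \<comment> \<open>The conditions form a star around \<open>auto G \<subseteq> auto H\<close>:
      uniqueness, equivariance and the normaliser condition are each linked to it, and normality is
      linked to the normaliser condition.\<close>
    ultimately show ?thesis
      using auto_subset_iff_unique[OF H] auto_subset_iff_equivariant[OF \<gamma> H op]
        normal_Hol_iff_auto_normalizer[OF \<gamma>, folded N] \<gamma> by blast
  qed
  have six: "gamma_function G \<gamma> \<and> gamma_equivariant G \<gamma> \<longleftrightarrow> gamma_antihom G \<gamma> \<and> gamma_equivariant G \<gamma>"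
    if "\<gamma> \<in> carrier G \<rightarrow>\<^sub>E auto G" for \<gamma>
    using equivariant_gamma_function_iff_antihom[OF that] by blast
  show ?thesis
  proof (intro conjI)
    show "bij_betw (gamma_operation G) {\<gamma>. gamma_function G \<gamma>} (skew_brace_operations G)"
      by (rule bij_betw_gamma_operation)
    show "bij_betw (gamma_subgroup G) {\<gamma>. gamma_function G \<gamma>} (regular_subgroups_Hol G)"
      by (rule bij_betw_gamma_subgroup)
    show "\<forall>\<gamma> (H :: 'a monoid).
        gamma_function G \<gamma> \<and> skew_brace G H \<and> operation H = gamma_operation G \<gamma>
        \<longrightarrow> gamma_subgroup G \<gamma> = right_mult H ` carrier H"
      by (intro allI impI, elim conjE, rule gamma_subgroup_eq_right_mults)
    show "\<forall>H :: 'a monoid. skew_brace G H \<and> auto G \<subseteq> auto H \<longrightarrow> bi_skew_brace G H"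
      by (intro allI impI, elim conjE, rule bi_skew_brace_if_auto_subset)
    show "\<forall>\<gamma> \<in> carrier G \<rightarrow>\<^sub>E auto G.
        gamma_function G \<gamma> \<and> gamma_equivariant G \<gamma>
        \<longleftrightarrow> gamma_antihom G \<gamma> \<and> gamma_equivariant G \<gamma>"
      using six by (rule ballI)
  qed (intro allI impI, elim conjE, rule equiv, assumption+)
qed

end
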